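(* Consider the second-order control system, the set $\mathcal{C}$, the functions $B_i$ and $B$ (depending on parameters $\gamma,\epsilon>0$), and the set $\mathcal{C}^s=\{x\in\mathbb{R}^{2n}: B(x)\ge 0\}$ described in the context. Suppose that (Assumption 1) $\operatorname{Proj}_n(\mathcal{C})$ is compact and, for every $I\in\mathcal{S}_\cap$, a point $y_I\in\mathcal{C}$ is chosen with $h_i(y_I)>0$ for all $i\in I$; let $\delta=\min_{I\in\mathcal{S}_\cap,\, i\in I}h_i(y_I)>0$. Let $\gamma,\epsilon>0$ satisfy $\gamma\delta>\epsilon$, and assume that $G_2(x)$ is right invertible for all $x\in\partial\mathcal{C}^s$ and that the allowable input set is $\mathcal{U}=\mathbb{R}^m$. Then the General Safety Condition is satisfied: for each $x\in\partial\mathcal{C}^s$ there exists $u_x\in\mathcal{U}=\mathbb{R}^m$ such that $$\nabla B_i(x)^\top\big(f(x)+G(x)u_x\big)>0\quad\text{for all } i\in\tilde{\mathcal{I}}(x).$$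
   Context: Dynamics: $\dot x=f(x)+G(x)u$ with $x=(x_1,x_2)$, $x_1,x_2\in\mathbb{R}^n$, $u\in\mathbb{R}^m$, $f(x)=(x_2,f_2(x))$, $G(x)=(\mathbf{0}_{n\times m},G_2(x))$ (stacked blocks), where $f_2:\mathbb{R}^{2n}\to\mathbb{R}^n$ and $G_2:\mathbb{R}^{2n}\to\mathbb{R}^{n\times m}$ are Lipschitz. $\mathcal{U}\subseteq\mathbb{R}^m$ is the set of allowable inputs. For a set $S\subseteq\mathbb{R}^{2n}$, $\operatorname{Proj}_n(S)\subseteq\mathbb{R}^n$ is its projection on the first $n$ components, and $\partial S$ is its boundary. Half-spaces: let $\mathcal{I}=\{1,\dots,r\}$. For $i\in\mathcal{I}$, let $a_i\in\mathbb{R}^n$, $b_i\in\mathbb{R}$ with $\|a_i\|\ne 0$ and $b_i\neq 0$, such that for $i\ne i'$ the augmented vectors $(a_i,b_i)$ and $(a_{i'},b_{i'})$ are linearly independent. Set $h_i(x)=a_i^\top x_1+b_i$ and $\mathcal{C}_i=\{x\in\mathbb{R}^{2n} : h_i(x)\ge 0\}$. Desired safe set: $\mathcal{L}\subset\mathbb{N}$ is a nonempty finite index set and $\mathcal{I}^\ell\subseteq\mathcal{I}$ is nonempty for each $\ell\in\mathcal{L}$. Set $\mathcal{C}=\bigcup_{\ell\in\mathcal{L}}\bigcap_{i\in\mathcal{I}^\ell}\mathcal{C}_i$, assumed nonempty. $\mathcal{S}_\cap$ is the collection of all $I\subseteq\mathcal{I}$ such that $\left(\bigcap_{i\in I}\mathcal{C}_i\right)\cap\mathcal{C}\neq\emptyset$.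 Construction of $B$: given parameters $\gamma,\epsilon>0$, for $1\le i\le r$ put $B_i(x)=h_i(x)$ and $B_{i+r}(x)=a_i^\top x_2+\gamma(a_i^\top x_1+b_i)-\epsilon$. Put $\bar{\mathcal{L}}=\mathcal{L}$, $\bar{\mathcal{I}}^\ell=\mathcal{I}^\ell\cup\{i+r : i\in\mathcal{I}^\ell\}$, $B^\ell(x)=\min_{i\in\bar{\mathcal{I}}^\ell}B_i(x)$, and $B(x)=\max_{\ell\in\bar{\mathcal{L}}}B^\ell(x)$. Active indices: $\mathcal{L}_i=\{\ell\in\bar{\mathcal{L}} : i\in\bar{\mathcal{I}}^\ell\}$ and $\tilde{\mathcal{I}}(x)=\{i\in\{1,\dots,2r\} : \exists\,\ell\in\mathcal{L}_i \text{ with } B(x)=B^\ell(x)=B_i(x)\}$. *)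

theory Defs
  imports "HOL-Analysis.Analysis"
begin

text \<open>
  The state space \<open>\<real>\<^sup>2\<^sup>n\<close> is rendered as the product of two copies of \<open>\<real>\<^sup>n\<close>, whose library norm and inner
  product are the Euclidean ones; \<open>x\<^sub>1\<close> is \<open>fst x\<close>, \<open>x\<^sub>2\<close> is \<open>snd x\<close>, and the projection on the
  first \<open>n\<close> components is \<open>fst\<close>. An \<open>n \<times> m\<close> matrix has type \<open>real ^ 'm ^ 'n\<close>.
\<close>

type_synonym 'n state = "(real ^ 'n) \<times> (real ^ 'n)"

definition drift :: "('n::finite state \<Rightarrow> real ^ 'n) \<Rightarrow> 'n state \<Rightarrow> 'n state" where
  "drift f2 x = (snd x, f2 x)"

text \<open>The stacked block matrix \<open>G(x) = (0, G\<^sub>2(x))\<close>, applied to an input.\<close>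

definition input_map ::
    "('n::finite state \<Rightarrow> real ^ 'm::finite ^ 'n) \<Rightarrow> 'n state \<Rightarrow> real ^ 'm \<Rightarrow> 'n state" where
  "input_map G2 x u = ((0 :: real ^ 'm ^ 'n) *v u, G2 x *v u)"

definition right_invertible :: "real ^ 'm::finite ^ 'n::finite \<Rightarrow> bool" where
  "right_invertible A \<longleftrightarrow> (\<exists>R :: real ^ 'n ^ 'm. A ** R = mat 1)"

definition gradient :: "('a::real_inner \<Rightarrow> real) \<Rightarrow> 'a \<Rightarrow> 'a" where
  "gradient F x = (THE D. gderiv F x D)"

lemma gradient_eqI:
  assumes "gderiv F x D"
  shows "gradient F x = D"
  unfolding gradient_def
proof (rule the_equality)
  show "gderiv F x D" by (fact assms)
next
  fix E assume "gderiv F x E"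
  then have "(\<lambda>h. h \<bullet> E) = (\<lambda>h. h \<bullet> D)"
    using assms unfolding gderiv_def by (rule has_derivative_unique)
  then have "(E - D) \<bullet> E = (E - D) \<bullet> D" by metis
  then have "(E - D) \<bullet> (E - D) = 0" by (simp add: inner_diff_right)
  then show "E = D" by simp
qed

definition h :: "(nat \<Rightarrow> real ^ 'n::finite) \<Rightarrow> (nat \<Rightarrow> real) \<Rightarrow> nat \<Rightarrow> 'n state \<Rightarrow> real" where
  "h a b i x = a i \<bullet> fst x + b i"

definition halfspace :: "(nat \<Rightarrow> real ^ 'n::finite) \<Rightarrow> (nat \<Rightarrow> real) \<Rightarrow> nat \<Rightarrow> 'n state set" where
  "halfspace a b i = {x. h a b i x \<ge> 0}"

definition safe_set ::
    "(nat \<Rightarrow> real ^ 'n::finite) \<Rightarrow> (nat \<Rightarrow> real) \<Rightarrow> nat set \<Rightarrow> (nat \<Rightarrow> nat set) \<Rightarrow> 'n state set" where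
  "safe_set a b L Idx = (\<Union>l\<in>L. \<Inter>i\<in>Idx l. halfspace a b i)"

text \<open>The collection \<open>S\<^sub>\<inter>\<close>. It may contain the empty index set, for which the intersection of
  half-spaces is the whole space.\<close>

definition S_cap ::
    "nat \<Rightarrow> (nat \<Rightarrow> real ^ 'n::finite) \<Rightarrow> (nat \<Rightarrow> real) \<Rightarrow> nat set \<Rightarrow> (nat \<Rightarrow> nat set) \<Rightarrow> nat set set" where
  "S_cap r a b L Idx =
     {I. I \<subseteq> {1..r} \<and> (\<Inter>i\<in>I. halfspace a b i) \<inter> safe_set a b L Idx \<noteq> {}}"

definition B_comp ::
    "nat \<Rightarrow> (nat \<Rightarrow> real ^ 'n::finite) \<Rightarrow> (nat \<Rightarrow> real) \<Rightarrow> real \<Rightarrow> real \<Rightarrow> nat \<Rightarrow> 'n state \<Rightarrow> real" where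
  "B_comp r a b \<gamma> \<epsilon> i x =
     (if i \<le> r then h a b i x
      else a (i - r) \<bullet> snd x + \<gamma> * (a (i - r) \<bullet> fst x + b (i - r)) - \<epsilon>)"

definition Idx_bar :: "nat \<Rightarrow> (nat \<Rightarrow> nat set) \<Rightarrow> nat \<Rightarrow> nat set" where
  "Idx_bar r Idx l = Idx l \<union> {i + r | i. i \<in> Idx l}"

definition B_min ::
    "nat \<Rightarrow> (nat \<Rightarrow> real ^ 'n::finite) \<Rightarrow> (nat \<Rightarrow> real) \<Rightarrow> (nat \<Rightarrow> nat set) \<Rightarrow> real \<Rightarrow> real
      \<Rightarrow> nat \<Rightarrow> 'n state \<Rightarrow> real" where
  "B_min r a b Idx \<gamma> \<epsilon> l x = Min ((\<lambda>i. B_comp r a b \<gamma> \<epsilon> i x) ` Idx_bar r Idx l)"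

definition B_max ::
    "nat \<Rightarrow> (nat \<Rightarrow> real ^ 'n::finite) \<Rightarrow> (nat \<Rightarrow> real) \<Rightarrow> nat set \<Rightarrow> (nat \<Rightarrow> nat set) \<Rightarrow> real \<Rightarrow> real
      \<Rightarrow> 'n state \<Rightarrow> real" where
  "B_max r a b L Idx \<gamma> \<epsilon> x = Max ((\<lambda>l. B_min r a b Idx \<gamma> \<epsilon> l x) ` L)"

definition C_s ::
    "nat \<Rightarrow> (nat \<Rightarrow> real ^ 'n::finite) \<Rightarrow> (nat \<Rightarrow> real) \<Rightarrow> nat set \<Rightarrow> (nat \<Rightarrow> nat set) \<Rightarrow> real \<Rightarrow> real
      \<Rightarrow> 'n state set" where
  "C_s r a b L Idx \<gamma> \<epsilon> = {x. B_max r a b L Idx \<gamma> \<epsilon> x \<ge> 0}"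

definition L_of :: "nat \<Rightarrow> nat set \<Rightarrow> (nat \<Rightarrow> nat set) \<Rightarrow> nat \<Rightarrow> nat set" where
  "L_of r L Idx i = {l \<in> L. i \<in> Idx_bar r Idx l}"

definition active ::
    "nat \<Rightarrow> (nat \<Rightarrow> real ^ 'n::finite) \<Rightarrow> (nat \<Rightarrow> real) \<Rightarrow> nat set \<Rightarrow> (nat \<Rightarrow> nat set) \<Rightarrow> real \<Rightarrow> real
      \<Rightarrow> 'n state \<Rightarrow> nat set" where
  "active r a b L Idx \<gamma> \<epsilon> x =
     {i \<in> {1..2 * r}. \<exists>l \<in> L_of r L Idx i.
        B_max r a b L Idx \<gamma> \<epsilon> x = B_min r a b Idx \<gamma> \<epsilon> l x \<and>
        B_min r a b Idx \<gamma> \<epsilon> l x = B_comp r a b \<gamma> \<epsilon> i x}"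

text \<open>The general safety condition for a set \<open>S\<close>, a family \<open>Bs\<close> of functions and an
  active-index map \<open>act\<close>, for dynamics \<open>x' = f x + G x u\<close> with inputs in \<open>U\<close>.\<close>

definition general_safety_condition ::
    "('s::real_inner \<Rightarrow> 's) \<Rightarrow> ('s \<Rightarrow> 'u \<Rightarrow> 's) \<Rightarrow> 'u set \<Rightarrow> 's set \<Rightarrow> (nat \<Rightarrow> 's \<Rightarrow> real)
      \<Rightarrow> ('s \<Rightarrow> nat set) \<Rightarrow> bool" where
  "general_safety_condition f G U S Bs act \<longleftrightarrow>
     (\<forall>x \<in> frontier S. \<exists>u \<in> U. \<forall>i \<in> act x. gradient (Bs i) x \<bullet> (f x + G x u) > 0)"

end

theory Submission
  imports Defs
begin

text \<open>
  Let \<open>x\<close> be a boundary point of \<open>C\<^sup>s\<close>, so that \<open>B(x) = 0\<close>. If \<open>i \<le> r\<close> is active, then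
  \<open>h\<^sub>i(x) = 0\<close> and \<open>B\<^sub>i\<^sub>+\<^sub>r(x) \<ge> 0\<close> force \<open>a\<^sub>i \<bullet> x\<^sub>2 \<ge> \<epsilon>\<close>, whatever the input is. Let \<open>J\<close> be the set of
  all \<open>j\<close> with \<open>j + r\<close> active. Every such \<open>j\<close> has \<open>h\<^sub>j(x) \<ge> 0\<close>, and \<open>x\<close> lies in the safe set, so \<open>J\<close>
  belongs to \<open>S\<^sub>\<inter>\<close> and has a chosen point \<open>y\<close>. For \<open>j\<close> in \<open>J\<close>,
  \<open>a\<^sub>j \<bullet> x\<^sub>2 + \<gamma> h\<^sub>j(x) = \<epsilon> < \<gamma> \<delta> \<le> \<gamma> h\<^sub>j(y)\<close>, which says that the single vector
  \<open>v = \<gamma> (y\<^sub>1 - x\<^sub>1) - x\<^sub>2\<close> satisfies \<open>a\<^sub>j \<bullet> v > 0\<close> for all these \<open>j\<close> at once. By right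
  invertibility there is an input with \<open>G\<^sub>2(x) u = v - \<gamma> x\<^sub>2 - f\<^sub>2(x)\<close>.
\<close>

text \<open>Each \<open>B_comp\<close> is affine in the state, so both gradient formulas below are
  instances of this one.\<close>

lemma gderiv_inner_state:
  fixes p q :: "'a::real_inner"
  shows "gderiv (\<lambda>x. p \<bullet> fst x + q \<bullet> snd x + c) x (p, q)"
  unfolding gderiv_def
  by (auto intro!: derivative_eq_intros simp: inner_prod_def inner_commute)

lemma gradient_B_comp_le:
  assumes "i \<le> r"
  shows "gradient (B_comp r a b \<gamma> \<epsilon> i) x = (a i, 0)"
proof (rule gradient_eqI)
  have "B_comp r a b \<gamma> \<epsilon> i = (\<lambda>x. a i \<bullet> fst x + 0 \<bullet> snd x + b i)"
    using assms by (auto simp: B_comp_def h_def)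
  then show "gderiv (B_comp r a b \<gamma> \<epsilon> i) x (a i, 0)"
    by (simp only: gderiv_inner_state)
qed

lemma gradient_B_comp_shift:
  assumes "j > 0"
  shows "gradient (B_comp r a b \<gamma> \<epsilon> (j + r)) x = (\<gamma> *\<^sub>R a j, a j)"
proof (rule gradient_eqI)
  have "B_comp r a b \<gamma> \<epsilon> (j + r) = (\<lambda>x. (\<gamma> *\<^sub>R a j) \<bullet> fst x + a j \<bullet> snd x + (\<gamma> * b j - \<epsilon>))"
    using assms by (auto simp: B_comp_def algebra_simps)
  then show "gderiv (B_comp r a b \<gamma> \<epsilon> (j + r)) x (\<gamma> *\<^sub>R a j, a j)"
    by (simp only: gderiv_inner_state)
qed

lemma continuous_on_B_comp: "continuous_on UNIV (B_comp r a b \<gamma> \<epsilon> i)"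
proof (cases "i \<le> r")
  case True
  then have "B_comp r a b \<gamma> \<epsilon> i = (\<lambda>x. a i \<bullet> fst x + b i)"
    by (auto simp: B_comp_def h_def)
  then show ?thesis by (auto intro!: continuous_intros)
next
  case False
  then have "B_comp r a b \<gamma> \<epsilon> i
      = (\<lambda>x. a (i - r) \<bullet> snd x + \<gamma> * (a (i - r) \<bullet> fst x + b (i - r)) - \<epsilon>)"
    by (auto simp: B_comp_def)
  then show ?thesis by (auto intro!: continuous_intros)
qed

lemma
  assumes "Idx l \<subseteq> {1..r}" "Idx l \<noteq> {}"
  shows finite_Idx_bar: "finite (Idx_bar r Idx l)"
    and Idx_bar_nonempty: "Idx_bar r Idx l \<noteq> {}"
proof -
  have "Idx_bar r Idx l = Idx l \<union> (\<lambda>i. i + r) ` Idx l"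
    by (auto simp: Idx_bar_def)
  moreover have "finite (Idx l)"
    using assms(1) finite_subset by blast
  ultimately show "finite (Idx_bar r Idx l)" "Idx_bar r Idx l \<noteq> {}"
    using assms(2) by auto
qed

text \<open>Since \<open>Idx l\<close> lies in \<open>{1..r}\<close>, it is disjoint from its copy
  shifted by \<open>r\<close>; hence an index of \<open>Idx_bar\<close> reveals which copy it comes
  from.\<close>

lemma
  assumes "Idx l \<subseteq> {1..r}"
  shows mem_Idx_bar_le: "i \<le> r \<Longrightarrow> i \<in> Idx_bar r Idx l \<Longrightarrow> i \<in> Idx l"
    and mem_Idx_bar_shift: "j > 0 \<Longrightarrow> j + r \<in> Idx_bar r Idx l \<Longrightarrow> j \<in> Idx l"
  using assms by (fastforce simp: Idx_bar_def)+

text \<open>A finite max of finite mins is \<open>\<ge> 0\<close> (or \<open>> 0\<close>) exactly on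
  a finite union of finite intersections of the corresponding sets of its continuous components. The
  first set is thus closed, and the second is open and inside the interior.\<close>

lemma B_max_frontier_C_s:
  fixes a :: "nat \<Rightarrow> real ^ 'n::finite"
  assumes L: "finite L" "L \<noteq> {}"
    and Idx: "\<forall>l\<in>L. Idx l \<subseteq> {1..r} \<and> Idx l \<noteq> {}"
    and x: "x \<in> frontier (C_s r a b L Idx \<gamma> \<epsilon>)"
  shows "B_max r a b L Idx \<gamma> \<epsilon> x = 0"
proof -
  have fin: "finite (Idx_bar r Idx l)" and ne: "Idx_bar r Idx l \<noteq> {}" if "l \<in> L" for l
    using finite_Idx_bar Idx_bar_nonempty Idx that by auto
  have "C_s r a b L Idx \<gamma> \<epsilon> = (\<Union>l\<in>L. \<Inter>i\<in>Idx_bar r Idx l. {x. 0 \<le> B_comp r a b \<gamma> \<epsilon> i x})"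
    using L fin ne by (auto simp: C_s_def B_max_def B_min_def Max_ge_iff)
  moreover have "closed \<dots>"
    using L(1) by (intro closed_UN closed_INT ballI closed_Collect_le
        continuous_on_const continuous_on_B_comp)
  ultimately have "closed (C_s r a b L Idx \<gamma> \<epsilon>)" by (simp only:)
  then have "0 \<le> B_max r a b L Idx \<gamma> \<epsilon> x"
    using x frontier_subset_closed by (fastforce simp: C_s_def)
  moreover have "\<not> 0 < B_max r a b L Idx \<gamma> \<epsilon> x"
  proof
    assume pos: "0 < B_max r a b L Idx \<gamma> \<epsilon> x"
    have "{x. 0 < B_max r a b L Idx \<gamma> \<epsilon> x}
        = (\<Union>l\<in>L. \<Inter>i\<in>Idx_bar r Idx l. {x. 0 < B_comp r a b \<gamma> \<epsilon> i x})"
      using L fin ne by (auto simp: B_max_def B_min_def Max_gr_iff)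
    moreover have "open \<dots>"
      using fin by (intro open_UN open_INT ballI open_Collect_less
          continuous_on_const continuous_on_B_comp)
    ultimately have "open {x. 0 < B_max r a b L Idx \<gamma> \<epsilon> x}" by (simp only:)
    moreover have "{x. 0 < B_max r a b L Idx \<gamma> \<epsilon> x} \<subseteq> C_s r a b L Idx \<gamma> \<epsilon>"
      by (auto simp: C_s_def)
    ultimately have "x \<in> interior (C_s r a b L Idx \<gamma> \<epsilon>)"
      using pos by (blast intro: interiorI)
    with x show False by (simp add: frontier_def)
  qed
  ultimately show ?thesis by linarith
qed

text \<open>The active component attains a minimum equal to 0, which bounds every other component
  with the same \<open>l\<close> from below.\<close>

lemma active_obtains:
  assumes Idx: "\<forall>l\<in>L. Idx l \<subseteq> {1..r} \<and> Idx l \<noteq> {}"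
    and B0: "B_max r a b L Idx \<gamma> \<epsilon> x = 0"
    and i: "i \<in> active r a b L Idx \<gamma> \<epsilon> x"
  obtains l where "l \<in> L" "i \<in> Idx_bar r Idx l" "B_comp r a b \<gamma> \<epsilon> i x = 0"
    "\<And>k. k \<in> Idx_bar r Idx l \<Longrightarrow> 0 \<le> B_comp r a b \<gamma> \<epsilon> k x"
proof -
  obtain l where l: "l \<in> L" "i \<in> Idx_bar r Idx l" "B_min r a b Idx \<gamma> \<epsilon> l x = 0"
    "B_comp r a b \<gamma> \<epsilon> i x = 0"
    using i B0 by (auto simp: active_def L_of_def)
  have "0 \<le> B_comp r a b \<gamma> \<epsilon> k x" if "k \<in> Idx_bar r Idx l" for k
  proof -
    have "finite (Idx_bar r Idx l)"
      using Idx l(1) by (intro finite_Idx_bar) auto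
    then have "B_min r a b Idx \<gamma> \<epsilon> l x \<le> B_comp r a b \<gamma> \<epsilon> k x"
      unfolding B_min_def using that by (intro Min_le) auto
    with l(3) show ?thesis by simp
  qed
  with l that show thesis by blast
qed

text \<open>For a right inverse \<open>R\<close>, the input \<open>R *v w\<close> works.\<close>

lemma right_invertible_surj:
  assumes "right_invertible A"
  obtains u where "A *v u = w"
  using assms unfolding right_invertible_def
  by (metis matrix_vector_mul_assoc matrix_vector_mul_lid)

theorem mainTheorem4:
  fixes f2 :: "'n::finite state \<Rightarrow> real ^ 'n"
    and G2 :: "'n state \<Rightarrow> real ^ 'm::finite ^ 'n"
    and U :: "(real ^ 'm) set"
    and r :: nat
    and a :: "nat \<Rightarrow> real ^ 'n"
    and b :: "nat \<Rightarrow> real"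
    and L :: "nat set"
    and Idx :: "nat \<Rightarrow> nat set"
    and y :: "nat set \<Rightarrow> 'n state"
    and \<gamma> \<epsilon> \<delta> :: real
  assumes f2_lipschitz: "\<exists>K. K-lipschitz_on UNIV f2"
    and G2_lipschitz: "\<exists>K. K-lipschitz_on UNIV G2"
    and a_nz: "\<And>i. i \<in> {1..r} \<Longrightarrow> norm (a i) \<noteq> 0"
    and b_nz: "\<And>i. i \<in> {1..r} \<Longrightarrow> b i \<noteq> 0"
    and lin_indep: "\<And>i j. i \<in> {1..r} \<Longrightarrow> j \<in> {1..r} \<Longrightarrow> i \<noteq> j \<Longrightarrow>
        (a i, b i) \<noteq> (a j, b j) \<and> independent {(a i, b i), (a j, b j)}"
    and L_fin: "finite L" and L_ne: "L \<noteq> {}"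
    and Idx_sub: "\<And>l. l \<in> L \<Longrightarrow> Idx l \<subseteq> {1..r}"
    and Idx_ne: "\<And>l. l \<in> L \<Longrightarrow> Idx l \<noteq> {}"
    and C_ne: "safe_set a b L Idx \<noteq> {}"
    and proj_compact: "compact (fst ` safe_set a b L Idx)"
    and y_in: "\<And>I. I \<in> S_cap r a b L Idx \<Longrightarrow> y I \<in> safe_set a b L Idx"
    and y_pos: "\<And>I i. I \<in> S_cap r a b L Idx \<Longrightarrow> i \<in> I \<Longrightarrow> h a b i (y I) > 0"
    and \<delta>_eq: "\<delta> = Min {h a b i (y I) | I i. I \<in> S_cap r a b L Idx \<and> i \<in> I}"
    and \<gamma>_pos: "\<gamma> > 0" and \<epsilon>_pos: "\<epsilon> > 0"
    and \<gamma>\<delta>: "\<gamma> * \<delta> > \<epsilon>"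
    and G2_right_inv: "\<And>x. x \<in> frontier (C_s r a b L Idx \<gamma> \<epsilon>) \<Longrightarrow> right_invertible (G2 x)"
    and U_all: "U = UNIV"
  shows "general_safety_condition (drift f2) (input_map G2) U (C_s r a b L Idx \<gamma> \<epsilon>)
           (B_comp r a b \<gamma> \<epsilon>) (active r a b L Idx \<gamma> \<epsilon>)"
proof -
  have Idx: "\<forall>l\<in>L. Idx l \<subseteq> {1..r} \<and> Idx l \<noteq> {}"
    using Idx_sub Idx_ne by blast
  have "\<exists>u. \<forall>i\<in>active r a b L Idx \<gamma> \<epsilon> x.
          gradient (B_comp r a b \<gamma> \<epsilon> i) x \<bullet> (drift f2 x + input_map G2 x u) > 0"
    if x: "x \<in> frontier (C_s r a b L Idx \<gamma> \<epsilon>)" for x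
  proof -
    have B0: "B_max r a b L Idx \<gamma> \<epsilon> x = 0"
      using B_max_frontier_C_s[OF L_fin L_ne Idx x] .
    note act = active_obtains[OF Idx B0]
    \<comment> \<open>The active index only serves to supply an \<open>l\<close> attaining the
      maximum.\<close>
    have safe: "x \<in> safe_set a b L Idx" if i: "i \<in> active r a b L Idx \<gamma> \<epsilon> x" for i
    proof -
      obtain l where l: "l \<in> L"
          "\<And>k. k \<in> Idx_bar r Idx l \<Longrightarrow> 0 \<le> B_comp r a b \<gamma> \<epsilon> k x"
        using act[OF i] by blast
      have "0 \<le> h a b k x" if "k \<in> Idx l" for k
        using l(2)[of k] Idx_sub[OF l(1)] that by (auto simp: Idx_bar_def B_comp_def)
      with l(1) show ?thesis by (auto simp: safe_set_def halfspace_def)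
    qed
    define J where "J = {j \<in> {1..r}. j + r \<in> active r a b L Idx \<gamma> \<epsilon> x}"
    have h_J: "0 \<le> h a b j x" if j: "j \<in> J" for j
    proof -
      have j': "j + r \<in> active r a b L Idx \<gamma> \<epsilon> x" "j > 0" "j \<le> r"
        using j by (auto simp: J_def)
      obtain l where l: "l \<in> L" "j + r \<in> Idx_bar r Idx l"
          "\<And>k. k \<in> Idx_bar r Idx l \<Longrightarrow> 0 \<le> B_comp r a b \<gamma> \<epsilon> k x"
        using act[OF j'(1)] by blast
      have "j \<in> Idx l"
        using mem_Idx_bar_shift[OF Idx_sub[OF l(1)] j'(2) l(2)] .
      with l(3)[of j] j'(3) show ?thesis by (auto simp: Idx_bar_def B_comp_def)
    qed
    have \<delta>_le: "\<delta> \<le> h a b j (y J)" if j: "j \<in> J" for j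
    proof -
      \<comment> \<open>The point \<open>x\<close> itself witnesses that the intersection is
        nonempty.\<close>
      have "J \<in> S_cap r a b L Idx"
        using safe h_J j by (fastforce simp: S_cap_def halfspace_def J_def)
      moreover have "finite {h a b i (y I) | I i. I \<in> S_cap r a b L Idx \<and> i \<in> I}"
        by (rule finite_subset[of _ "(\<lambda>(I, i). h a b i (y I)) ` (Pow {1..r} \<times> {1..r})"])
          (auto simp: S_cap_def)
      ultimately show ?thesis
        unfolding \<delta>_eq using j by (blast intro: Min_le)
    qed
    \<comment> \<open>The input will be chosen so that \<open>v\<close> is \<open>\<gamma>\<close>
      times the velocity plus the acceleration; \<open>a j \<bullet> v\<close> is then the rate of
      change of component \<open>j + r\<close>. For empty \<open>J\<close> nothing is asked of
      \<open>v\<close>.\<close>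
    define v where "v = \<gamma> *\<^sub>R (fst (y J) - fst x) - snd x"
    have v_pos: "a j \<bullet> v > 0" if j: "j \<in> J" for j
    proof -
      have "B_comp r a b \<gamma> \<epsilon> (j + r) x = 0" "j > 0"
        using act j by (auto simp: J_def)
      then have "a j \<bullet> snd x + \<gamma> * (a j \<bullet> fst x + b j) = \<epsilon>"
        by (simp add: B_comp_def)
      moreover have "\<epsilon> < \<gamma> * (a j \<bullet> fst (y J) + b j)"
        using \<gamma>\<delta> mult_left_mono[OF \<delta>_le[OF j] less_imp_le[OF \<gamma>_pos]]
        unfolding h_def by linarith
      ultimately show ?thesis
        by (simp add: v_def inner_diff_right algebra_simps)
    qed
    obtain u where u: "G2 x *v u = v - \<gamma> *\<^sub>R snd x - f2 x"
      using right_invertible_surj[OF G2_right_inv[OF x]] .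
    have dyn: "drift f2 x + input_map G2 x u = (snd x, v - \<gamma> *\<^sub>R snd x)"
      by (simp add: drift_def input_map_def u)
    have "gradient (B_comp r a b \<gamma> \<epsilon> i) x \<bullet> (drift f2 x + input_map G2 x u) > 0"
      if i: "i \<in> active r a b L Idx \<gamma> \<epsilon> x" for i
    proof (cases "i \<le> r")
      case True
      obtain l where l: "l \<in> L" "i \<in> Idx_bar r Idx l" "B_comp r a b \<gamma> \<epsilon> i x = 0"
          "\<And>k. k \<in> Idx_bar r Idx l \<Longrightarrow> 0 \<le> B_comp r a b \<gamma> \<epsilon> k x"
        using act[OF i] by blast
      have "i \<in> Idx l"
        using mem_Idx_bar_le[OF Idx_sub[OF l(1)] True l(2)] .
      \<comment> \<open>The partner \<open>i + r\<close> belongs to the same \<open>l\<close>, so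
        its component is bounded below as well.\<close>
      then have "0 \<le> B_comp r a b \<gamma> \<epsilon> (i + r) x" "i > 0"
        using l(1,4) Idx_sub by (fastforce simp: Idx_bar_def)+
      then have "a i \<bullet> snd x > 0"
        using l(3) True \<epsilon>_pos by (simp add: B_comp_def h_def)
      then show ?thesis
        by (simp add: gradient_B_comp_le[OF True] dyn)
    next
      case False
      define j where "j = i - r"
      have j: "i = j + r" "j > 0" using False by (auto simp: j_def)
      with i have "j \<in> J" by (auto simp: J_def active_def)
      \<comment> \<open>The terms in \<open>\<gamma> *\<^sub>R snd x\<close> cancel, leaving
        \<open>a j \<bullet> v\<close>.\<close>
      then show ?thesis
        using v_pos
        by (simp add: j(1) gradient_B_comp_shift[OF j(2)] dyn inner_diff_right)
    qed
    then show ?thesis by blast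
  qed
  then show ?thesis
    by (simp add: general_safety_condition_def U_all)
qed

end
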